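(* Let $n\ge 2$, $N=\{1,\dots,n\}$, and let $A=[a_{ij}]\in\mathbb{C}^{n,n}$ be a Nekrasov matrix. Then for every real $\mu>\frac{r_1(A)}{|a_{11}|}$, $$\|A^{-1}\|_\infty \le \max\{\mu,1\}\,\max_{i\in N}\frac{z_i(A)}{|a_{ii}|}\,\max\left\{\frac{1}{\mu-\frac{h_1(A)}{|a_{11}|}},\ \frac{1}{1-\max\limits_{i\ne 1}\frac{h_i(A)}{|a_{ii}|}}\right\},$$ and $$\|A^{-1}\|_\infty \le \frac{\max\{\mu,1\}\,\max\limits_{i\in N} z_i(A)}{\min\left\{\mu|a_{11}|-h_1(A),\ \min\limits_{i\ne 1}\left(|a_{ii}|-h_i(A)\right)\right\}}.$$
   Context: For $A=[a_{ij}]\in\mathbb{C}^{n,n}$ and $N=\{1,\dots,n\}$, put $r_i(A)=\sum_{j\ne i}|a_{ij}|$. Define recursively $h_1(A)=r_1(A)=\sum_{j\neq 1}|a_{1j}|$ and $h_i(A)=\sum_{j=1}^{i-1}\frac{|a_{ij}|}{|a_{jj}|}h_j(A)+\sum_{j=i+1}^{n}|a_{ij}|$ for $i=2,\dots,n$. Define $z_1(A)=1$ and $z_i(A)=\sum_{j=1}^{i-1}\frac{|a_{ij}|}{|a_{jj}|}z_j(A)+1$ for $i=2,\dots,n$. $A$ is called a Nekrasov matrix if $|a_{ii}|>h_i(A)$ for every $i\in N$. $\|\cdot\|_\infty$ is the matrix norm induced by the vector infinity norm (maximum absolute row sum). "$i\neq 1$" means $i\in N\setminus\{1\}$. *)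

theory Defs
  imports "Jordan_Normal_Form.Gauss_Jordan_Elimination" Complex_Main
begin

text \<open>Matrices and vectors are indexed from 0: the row index \<open>i\<close> of the literature, with
  \<open>1 \<le> i \<le> n\<close>, is \<open>i - 1\<close> here, so the distinguished first row is row \<open>0\<close>.\<close>

definition offdiag_row_sum :: "complex mat \<Rightarrow> nat \<Rightarrow> real" where
  "offdiag_row_sum A i = (\<Sum>j \<in> {..<dim_col A} - {i}. cmod (A $$ (i, j)))"

fun nekrasov_h :: "complex mat \<Rightarrow> nat \<Rightarrow> real" where
  "nekrasov_h A i =
    (if i = 0 then offdiag_row_sum A 0
     else (\<Sum>j\<in>{..<i}. cmod (A $$ (i, j)) / cmod (A $$ (j, j)) * nekrasov_h A j)
        + (\<Sum>j\<in>{i+1..<dim_col A}. cmod (A $$ (i, j))))"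

fun nekrasov_z :: "complex mat \<Rightarrow> nat \<Rightarrow> real" where
  "nekrasov_z A i =
    (if i = 0 then 1
     else (\<Sum>j\<in>{..<i}. cmod (A $$ (i, j)) / cmod (A $$ (j, j)) * nekrasov_z A j) + 1)"

declare nekrasov_h.simps [simp del] nekrasov_z.simps [simp del]

definition nekrasov_mat :: "complex mat \<Rightarrow> bool" where
  "nekrasov_mat A \<longleftrightarrow>
     square_mat A \<and> (\<forall>i<dim_row A. cmod (A $$ (i, i)) > nekrasov_h A i)"

definition vec_norm_inf :: "complex vec \<Rightarrow> real" where
  "vec_norm_inf v = Max ((\<lambda>i. cmod (v $ i)) ` {..<dim_vec v})"

definition mat_norm_inf :: "complex mat \<Rightarrow> real" where
  "mat_norm_inf M =
     (SUP v\<in>{v \<in> carrier_vec (dim_col M). vec_norm_inf v = 1}. vec_norm_inf (M *\<^sub>v v))"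

text \<open>The inverse; meaningful for invertible matrices only (see \<open>mat_inv\<close> below).\<close>

definition mat_inv :: "complex mat \<Rightarrow> complex mat" where
  "mat_inv A = the (mat_inverse A)"

lemma mat_inv:
  assumes A: "A \<in> carrier_mat n n" and inv: "invertible_mat A"
  shows "mat_inv A \<in> carrier_mat n n" "A * mat_inv A = 1\<^sub>m n" "mat_inv A * A = 1\<^sub>m n"
proof -
  obtain B where B: "A * B = 1\<^sub>m n" "B * A = 1\<^sub>m (dim_row B)"
    using inv A by (auto simp: invertible_mat_def inverts_mat_def)
  have "dim_col B = n" using arg_cong[OF B(1), of dim_col] by simp
  moreover have "dim_row B = n" using arg_cong[OF B(2), of dim_col] A by simp
  ultimately have Bc: "B \<in> carrier_mat n n" by auto
  have "A \<in> Units (ring_mat TYPE(complex) n ())"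
    using A B Bc by (auto simp: Units_def ring_mat_def)
  with mat_inverse(1)[OF A, of "()"] obtain C where C: "mat_inverse A = Some C"
    by (cases "mat_inverse A") auto
  from mat_inverse(2)[OF A C] C
  show "mat_inv A \<in> carrier_mat n n" "A * mat_inv A = 1\<^sub>m n" "mat_inv A * A = 1\<^sub>m n"
    by (auto simp: mat_inv_def)
qed

lemma cmod_le_vec_norm_inf: "i < dim_vec v \<Longrightarrow> cmod (v $ i) \<le> vec_norm_inf v"
  unfolding vec_norm_inf_def by (rule Max_ge) auto

lemma vec_norm_inf_le:
  assumes "0 < dim_vec v" "\<And>i. i < dim_vec v \<Longrightarrow> cmod (v $ i) \<le> c"
  shows "vec_norm_inf v \<le> c"
  unfolding vec_norm_inf_def using assms by (subst Max_le_iff) auto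

lemma mat_norm_inf_row_sum:
  assumes M: "M \<in> carrier_mat m n" and "0 < m" "0 < n"
  shows "mat_norm_inf M = Max ((\<lambda>i. \<Sum>j<n. cmod (M $$ (i, j))) ` {..<m})"
    (is "_ = Max (?s ` _)")
proof -
  let ?S = "{v \<in> carrier_vec n. vec_norm_inf v = 1}"
  let ?R = "Max (?s ` {..<m})"
  have entry: "(M *\<^sub>v v) $ i = (\<Sum>j<n. M $$ (i, j) * v $ j)"
    if "v \<in> carrier_vec n" "i < m" for v i
    using that M by (auto simp: scalar_prod_def atLeast0LessThan intro!: sum.cong)
  have upper: "vec_norm_inf (M *\<^sub>v v) \<le> ?R" if "v \<in> ?S" for v
  proof (rule vec_norm_inf_le)
    show "0 < dim_vec (M *\<^sub>v v)" using assms by auto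
    fix i assume "i < dim_vec (M *\<^sub>v v)"
    hence i: "i < m" using M by auto
    have "cmod ((M *\<^sub>v v) $ i) \<le> (\<Sum>j<n. cmod (M $$ (i, j) * v $ j))"
      using that i by (simp add: entry norm_sum)
    also have "\<dots> \<le> ?s i"
    proof (rule sum_mono)
      fix j assume "j \<in> {..<n}"
      hence "cmod (v $ j) \<le> 1" using that cmod_le_vec_norm_inf[of j v] by auto
      thus "cmod (M $$ (i, j) * v $ j) \<le> cmod (M $$ (i, j))"
        by (simp add: norm_mult mult_left_le)
    qed
    also have "\<dots> \<le> ?R" using i by (intro Max_ge) auto
    finally show "cmod ((M *\<^sub>v v) $ i) \<le> ?R" .
  qed
  have "?R \<in> ?s ` {..<m}" using assms by (intro Max_in) auto
  then obtain i where i: "i < m" "?R = ?s i" by auto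
  define v where "v = vec n (\<lambda>j. if M $$ (i, j) = 0 then 1 else cnj (sgn (M $$ (i, j))))"
  have v1: "cmod (v $ j) = 1" if "j < n" for j
    using that by (simp add: v_def norm_sgn)
  have vc: "v \<in> carrier_vec n" by (simp add: v_def)
  have "vec_norm_inf v \<le> 1" using vc v1 assms by (intro vec_norm_inf_le) auto
  moreover have "1 \<le> vec_norm_inf v"
    using cmod_le_vec_norm_inf[of 0 v] v1[of 0] vc assms by auto
  ultimately have vS: "v \<in> ?S" using vc by simp
  have prod: "z * cnj (sgn z) = of_real (cmod z)" for z :: complex
  proof -
    have "z * cnj (sgn z) = (z * cnj z) / of_real (cmod z)"
      by (simp add: sgn_eq)
    also have "\<dots> = of_real (cmod z ^ 2) / of_real (cmod z)"
      by (simp only: complex_norm_square)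
    also have "\<dots> = of_real (cmod z)"
      by (simp add: power2_eq_square)
    finally show ?thesis .
  qed
  have "(M *\<^sub>v v) $ i = of_real (?s i)"
    unfolding entry[OF vc i(1)] of_real_sum
    by (rule sum.cong) (auto simp: v_def prod)
  hence "cmod ((M *\<^sub>v v) $ i) = ?s i"
    by (simp only: norm_of_real abs_of_nonneg[OF sum_nonneg[OF norm_ge_zero]])
  hence lower: "?R \<le> vec_norm_inf (M *\<^sub>v v)"
    using cmod_le_vec_norm_inf[of i "M *\<^sub>v v"] M i by auto
  have "(SUP v\<in>?S. vec_norm_inf (M *\<^sub>v v)) = ?R"
  proof (rule antisym)
    show "(SUP v\<in>?S. vec_norm_inf (M *\<^sub>v v)) \<le> ?R"
      using vS upper by (intro cSUP_least) auto
    have "bdd_above ((\<lambda>v. vec_norm_inf (M *\<^sub>v v)) ` ?S)"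
      using upper by (auto intro!: bdd_aboveI)
    from cSUP_upper2[OF this vS lower] show "?R \<le> (SUP v\<in>?S. vec_norm_inf (M *\<^sub>v v))" .
  qed
  thus ?thesis using M by (simp add: mat_norm_inf_def)
qed

end

theory Submission
  imports Defs "Jordan_Normal_Form.Determinant"
begin

text \<open>
  The proof bounds the solution of a linear system \<open>A x = y\<close> directly. Write \<open>a\<^sub>i\<close> for the modulus of
  the \<open>i\<close>-th diagonal entry, \<open>h\<^sub>i\<close> and \<open>z\<^sub>i\<close> for the two Nekrasov recursions, and suppose that every
  entry of \<open>y\<close> has modulus at most \<open>Y\<close>. Forward substitution through the lower triangle, with a
  common bound \<open>m\<close> for all \<open>\<bar>x\<^sub>j\<bar>\<close> that meet entries above the diagonal, gives
  \<open>a\<^sub>i \<bar>x\<^sub>i\<bar> \<le> h\<^sub>i m + z\<^sub>i Y\<close>: the recursion for \<open>h\<close> carries the contribution of \<open>m\<close> and the recursion for \<open>z\<close> that of \<open>Y\<close>. The unknown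
  \<open>x\<^sub>0\<close> never meets an entry above the diagonal, so \<open>m\<close> may be taken as the
  maximum of the \<open>\<bar>x\<^sub>j\<bar>\<close> with \<open>j > 0\<close> alone.
  This is why the first row can be treated separately, with a free parameter \<open>\<mu>\<close>.

  Suppose the maximum \<open>m\<close> is attained at \<open>k > 0\<close>. Then \<open>(a\<^sub>k - h\<^sub>k) m \<le> z\<^sub>k Y\<close>, so \<open>m \<le> B\<close> for every
  \<open>B\<close> with \<open>z\<^sub>i Y \<le> (a\<^sub>i - h\<^sub>i) B\<close> in all rows \<open>i > 0\<close>. If moreover \<open>Y \<le> (\<mu> a\<^sub>0 - h\<^sub>0) B\<close>, then the
  first row yields \<open>a\<^sub>0 \<bar>x\<^sub>0\<bar> \<le> h\<^sub>0 B + Y \<le> \<mu> a\<^sub>0 B\<close>. Hence all entries of \<open>x\<close> are at most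
  \<open>max \<mu> 1 * B\<close> (lemma \<open>nekrasov_solution_bound\<close>). The choice \<open>Y = B = 0\<close> shows that \<open>A\<close> has trivial
  kernel; with \<open>Y = 1\<close>, the two bounds on the inverse come from two values of \<open>B\<close>, depending on
  whether the rows are compared after or before division by \<open>a\<^sub>i\<close>.
\<close>

section \<open>The Nekrasov recursions\<close>

text \<open>The first row obeys the general recursion with an empty sum over \<open>j < 0\<close>. In this form
  one induction step covers the first row together with the others.\<close>

lemma nekrasov_h_unfold:
  "nekrasov_h A i = (\<Sum>j<i. cmod (A $$ (i, j)) / cmod (A $$ (j, j)) * nekrasov_h A j)
     + (\<Sum>j\<in>{i+1..<dim_col A}. cmod (A $$ (i, j)))"
proof (cases "i = 0")
  case True
  have "{..<dim_col A} - {0} = {1..<dim_col A}" by auto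
  with True show ?thesis
    by (simp add: nekrasov_h.simps[of A 0] offdiag_row_sum_def)
next
  case False
  then show ?thesis by (subst nekrasov_h.simps) simp
qed

lemma nekrasov_z_unfold:
  "nekrasov_z A i = (\<Sum>j<i. cmod (A $$ (i, j)) / cmod (A $$ (j, j)) * nekrasov_z A j) + 1"
  by (subst nekrasov_z.simps) simp

lemma nekrasov_h_nonneg: "0 \<le> nekrasov_h A i"
  by (induction i rule: less_induct, subst nekrasov_h_unfold)
     (auto intro!: add_nonneg_nonneg sum_nonneg mult_nonneg_nonneg)

lemma nekrasov_diag_pos:
  assumes "nekrasov_mat A" and "A \<in> carrier_mat n n" and "i < n"
  shows "0 < cmod (A $$ (i, i))"
  using assms nekrasov_h_nonneg[of A i] by (fastforce simp: nekrasov_mat_def)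

section \<open>Bounds for solutions of linear systems\<close>

lemma mult_mat_vec_entry:
  assumes "A \<in> carrier_mat m n" and "x \<in> carrier_vec n" and "i < m"
  shows "(A *\<^sub>v x) $ i = (\<Sum>j<n. A $$ (i, j) * x $ j)"
  using assms by (auto simp: scalar_prod_def atLeast0LessThan intro!: sum.cong)

text \<open>Forward substitution in absolute values: unknowns left of the diagonal are bounded by
  induction, and unknowns right of it, whose index is at least \<open>1\<close>, are bounded by \<open>m\<close>.\<close>

lemma nekrasov_forward_substitution:
  assumes A: "A \<in> carrier_mat n n" and x: "x \<in> carrier_vec n"
    and diag: "\<And>i. i < n \<Longrightarrow> 0 < cmod (A $$ (i, i))"
    and Y: "\<And>i. i < n \<Longrightarrow> cmod ((A *\<^sub>v x) $ i) \<le> Y"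
    and m: "\<And>j. 0 < j \<Longrightarrow> j < n \<Longrightarrow> cmod (x $ j) \<le> m"
    and "i < n"
  shows "cmod (A $$ (i, i)) * cmod (x $ i) \<le> nekrasov_h A i * m + nekrasov_z A i * Y"
  using \<open>i < n\<close>
proof (induction i rule: less_induct)
  case (less i)
  let ?t = "\<lambda>j. A $$ (i, j) * x $ j"
  let ?q = "\<lambda>j. cmod (A $$ (i, j)) / cmod (A $$ (j, j))"
  have split: "{..<n} = {..<i} \<union> ({i} \<union> {i+1..<n})" using less.prems by auto
  have "(A *\<^sub>v x) $ i = (\<Sum>j<n. ?t j)"
    using A x less.prems by (rule mult_mat_vec_entry)
  also have "\<dots> = (\<Sum>j<i. ?t j) + (?t i + (\<Sum>j\<in>{i+1..<n}. ?t j))"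
    unfolding split by (subst sum.union_disjoint; (subst sum.union_disjoint)?) auto
  finally have "?t i = (A *\<^sub>v x) $ i - (\<Sum>j<i. ?t j) - (\<Sum>j\<in>{i+1..<n}. ?t j)"
    by simp
  from arg_cong[OF this, of cmod]
  have "cmod (?t i) \<le> cmod ((A *\<^sub>v x) $ i) + cmod (\<Sum>j<i. ?t j) + cmod (\<Sum>j\<in>{i+1..<n}. ?t j)"
    using norm_triangle_ineq4[of "(A *\<^sub>v x) $ i" "\<Sum>j<i. ?t j"]
      norm_triangle_ineq4[of "(A *\<^sub>v x) $ i - (\<Sum>j<i. ?t j)" "\<Sum>j\<in>{i+1..<n}. ?t j"]
    by linarith
  moreover have "cmod (\<Sum>j<i. ?t j) \<le> (\<Sum>j<i. ?q j * (nekrasov_h A j * m + nekrasov_z A j * Y))"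
  proof (rule sum_norm_le)
    fix j assume "j \<in> {..<i}"
    then have j: "j < i" "j < n" using less.prems by auto
    have "cmod (?t j) = ?q j * (cmod (A $$ (j, j)) * cmod (x $ j))"
      using diag[OF j(2)] by (simp add: norm_mult)
    also have "\<dots> \<le> ?q j * (nekrasov_h A j * m + nekrasov_z A j * Y)"
      by (intro mult_left_mono less.IH j) simp
    finally show "cmod (?t j) \<le> ?q j * (nekrasov_h A j * m + nekrasov_z A j * Y)" .
  qed
  moreover have "cmod (\<Sum>j\<in>{i+1..<n}. ?t j) \<le> (\<Sum>j\<in>{i+1..<n}. cmod (A $$ (i, j)) * m)"
    by (rule sum_norm_le) (auto simp: norm_mult intro!: mult_left_mono m)
  ultimately have "cmod (?t i) \<le> Y + (\<Sum>j<i. ?q j * (nekrasov_h A j * m + nekrasov_z A j * Y))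
      + (\<Sum>j\<in>{i+1..<n}. cmod (A $$ (i, j)) * m)"
    using Y[OF less.prems] by linarith
  also have "\<dots> = nekrasov_h A i * m + nekrasov_z A i * Y"
    using A by (subst nekrasov_h_unfold[of A i], subst nekrasov_z_unfold[of A i])
      (simp add: algebra_simps add_divide_distrib sum.distrib sum_distrib_left sum_distrib_right)
  finally show ?case by (simp add: norm_mult)
qed

text \<open>The number \<open>B\<close> is a common certificate: it majorises the entries of \<open>x\<close> past the first, while
  \<open>\<mu> B\<close> majorises the first one.\<close>

lemma nekrasov_solution_bound:
  fixes \<mu> Y B :: real
  assumes n: "n \<ge> 2" and A: "A \<in> carrier_mat n n" and nek: "nekrasov_mat A"
    and x: "x \<in> carrier_vec n"
    and Y: "\<And>i. i < n \<Longrightarrow> cmod ((A *\<^sub>v x) $ i) \<le> Y"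
    and first: "Y \<le> (\<mu> * cmod (A $$ (0, 0)) - nekrasov_h A 0) * B"
    and rest: "\<And>i. 0 < i \<Longrightarrow> i < n \<Longrightarrow>
      nekrasov_z A i * Y \<le> (cmod (A $$ (i, i)) - nekrasov_h A i) * B"
    and "i < n"
  shows "cmod (x $ i) \<le> max \<mu> 1 * B"
proof -
  define m where "m = (MAX j\<in>{1..<n}. cmod (x $ j))"
  have m: "cmod (x $ j) \<le> m" if "0 < j" "j < n" for j
    using that unfolding m_def by (intro Max_ge) auto
  have subst_bound: "cmod (A $$ (j, j)) * cmod (x $ j) \<le> nekrasov_h A j * m + nekrasov_z A j * Y"
    if "j < n" for j
    by (rule nekrasov_forward_substitution[OF A x nekrasov_diag_pos[OF nek A] Y m that])
  have "m \<in> (\<lambda>j. cmod (x $ j)) ` {1..<n}"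
    using n unfolding m_def by (intro Max_in) auto
  then obtain k where k: "0 < k" "k < n" "m = cmod (x $ k)"
    by (auto simp: Suc_le_eq)
  have "(cmod (A $$ (k, k)) - nekrasov_h A k) * m \<le> nekrasov_z A k * Y"
    using subst_bound[OF k(2)] k(3) by (simp add: algebra_simps)
  also note rest[OF k(1,2)]
  finally have "m \<le> B"
    using nek A k(2) by (auto simp: nekrasov_mat_def)
  moreover have "0 \<le> m" by (simp add: k(3))
  ultimately have B: "0 \<le> B" by simp
  show ?thesis
  proof (cases "i = 0")
    case True
    have a0: "0 < cmod (A $$ (0, 0))"
      using n by (intro nekrasov_diag_pos[OF nek A]) simp
    have "cmod (A $$ (0, 0)) * cmod (x $ 0) \<le> nekrasov_h A 0 * m + Y"
      using subst_bound[of 0] n by (simp add: nekrasov_z_unfold[of A 0])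
    also have "\<dots> \<le> nekrasov_h A 0 * B + Y"
      using \<open>m \<le> B\<close> by (simp add: mult_left_mono nekrasov_h_nonneg)
    also have "\<dots> \<le> cmod (A $$ (0, 0)) * (\<mu> * B)"
      using first by (simp add: algebra_simps)
    finally have "cmod (x $ 0) \<le> \<mu> * B"
      using a0 by simp
    also have "\<dots> \<le> max \<mu> 1 * B"
      using B by (intro mult_right_mono) auto
    finally show ?thesis using True by simp
  next
    case False
    then have "cmod (x $ i) \<le> 1 * B"
      using m[of i] \<open>i < n\<close> \<open>m \<le> B\<close> by simp
    also have "\<dots> \<le> max \<mu> 1 * B"
      using B by (intro mult_right_mono) auto
    finally show ?thesis .
  qed
qed

section \<open>Invertibility and bounds for the inverse\<close>

lemma invertible_mat_if_trivial_kernel: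
  fixes A :: "'a :: field mat"
  assumes A: "A \<in> carrier_mat n n"
    and ker: "\<And>x. x \<in> carrier_vec n \<Longrightarrow> A *\<^sub>v x = 0\<^sub>v n \<Longrightarrow> x = 0\<^sub>v n"
  shows "invertible_mat A"
proof -
  have "det A \<noteq> 0"
    using ker det_0_iff_vec_prod_zero[OF A] by blast
  from det_non_zero_imp_unit[OF A this] obtain B where
    "B \<in> carrier_mat n n" "A * B = 1\<^sub>m n" "B * A = 1\<^sub>m n"
    by (auto simp: Units_def ring_mat_def)
  then show ?thesis
    using A by (auto simp: invertible_mat_def inverts_mat_def)
qed

lemma nekrasov_invertible:
  assumes n: "n \<ge> 2" and A: "A \<in> carrier_mat n n" and nek: "nekrasov_mat A"
  shows "invertible_mat A"
proof (rule invertible_mat_if_trivial_kernel[OF A])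
  fix x assume x: "x \<in> carrier_vec n" and ker: "A *\<^sub>v x = 0\<^sub>v n"
  have "cmod (x $ i) \<le> max 1 1 * 0" if "i < n" for i
    by (rule nekrasov_solution_bound[OF n A nek x, where Y = 0])
       (use ker that in auto)
  then show "x = 0\<^sub>v n"
    using x by (intro eq_vecI) auto
qed

lemma nekrasov_inverse_bound:
  fixes \<mu> B :: real
  assumes n: "n \<ge> 2" and A: "A \<in> carrier_mat n n" and nek: "nekrasov_mat A"
    and first: "1 \<le> (\<mu> * cmod (A $$ (0, 0)) - nekrasov_h A 0) * B"
    and rest: "\<And>i. 0 < i \<Longrightarrow> i < n \<Longrightarrow>
      nekrasov_z A i \<le> (cmod (A $$ (i, i)) - nekrasov_h A i) * B"
  shows "mat_norm_inf (mat_inv A) \<le> max \<mu> 1 * B"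
proof -
  note inv = mat_inv[OF A nekrasov_invertible[OF n A nek]]
  let ?S = "{v \<in> carrier_vec n. vec_norm_inf v = 1}"
  have "vec n (\<lambda>_. 1) \<in> ?S"
    using n by (auto simp: vec_norm_inf_def image_constant_conv lessThan_empty_iff)
  then have "?S \<noteq> {}" by blast
  moreover have "vec_norm_inf (mat_inv A *\<^sub>v v) \<le> max \<mu> 1 * B" if "v \<in> ?S" for v
  proof (rule vec_norm_inf_le)
    let ?x = "mat_inv A *\<^sub>v v"
    show "0 < dim_vec ?x" using inv(1) n by auto
    fix i assume "i < dim_vec ?x"
    then have i: "i < n" using inv(1) by auto
    have x: "?x \<in> carrier_vec n" using inv(1) that by auto
    have "A *\<^sub>v ?x = (A * mat_inv A) *\<^sub>v v"
      using A inv(1) that by (intro assoc_mult_mat_vec[symmetric]) auto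
    then have Ax: "A *\<^sub>v ?x = v"
      using inv(2) that by simp
    show "cmod (?x $ i) \<le> max \<mu> 1 * B"
    proof (rule nekrasov_solution_bound[OF n A nek x _ first _ i])
      show "cmod ((A *\<^sub>v ?x) $ j) \<le> 1" if "j < n" for j
        using cmod_le_vec_norm_inf[of j v] \<open>v \<in> ?S\<close> that Ax by auto
    qed (use rest in simp)
  qed
  ultimately have "(SUP v\<in>?S. vec_norm_inf (mat_inv A *\<^sub>v v)) \<le> max \<mu> 1 * B"
    by (rule cSUP_least)
  then show ?thesis
    using inv(1) by (simp add: mat_norm_inf_def)
qed

text \<open>The diagonal is divided out of every row first, so the row conditions on \<open>B\<close> read
  \<open>z\<^sub>i / a\<^sub>i \<le> (1 - h\<^sub>i / a\<^sub>i) B\<close>; numerator and gap are then bounded separately, by their worst rows.\<close>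

lemma nekrasov_inverse_bound_scaled:
  fixes \<mu> :: real
  assumes n: "n \<ge> 2" and A: "A \<in> carrier_mat n n" and nek: "nekrasov_mat A"
    and \<mu>: "nekrasov_h A 0 / cmod (A $$ (0, 0)) < \<mu>"
  shows "mat_norm_inf (mat_inv A) \<le>
      max \<mu> 1 * (MAX i\<in>{..<n}. nekrasov_z A i / cmod (A $$ (i, i))) *
      max (1 / (\<mu> - nekrasov_h A 0 / cmod (A $$ (0, 0))))
          (1 / (1 - (MAX i\<in>{..<n} - {0}. nekrasov_h A i / cmod (A $$ (i, i)))))"
    (is "_ \<le> _ * ?Z * max (1 / ?g) (1 / (1 - ?H))")
proof -
  let ?K = "max (1 / ?g) (1 / (1 - ?H))"
  note pos = nekrasov_diag_pos[OF nek A]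
  have Z: "nekrasov_z A i / cmod (A $$ (i, i)) \<le> ?Z" if "i < n" for i
    using that by (intro Max_ge) auto
  have H: "nekrasov_h A i / cmod (A $$ (i, i)) \<le> ?H" if "0 < i" "i < n" for i
    using that by (intro Max_ge) auto
  have "1 \<in> {..<n} - {0}" using n by simp
  then have ne: "{..<n} - {0} \<noteq> {}" by blast
  have "?H < 1"
    using ne nek A pos by (subst Max_less_iff) (auto simp: nekrasov_mat_def)
  have "0 < ?g" using \<mu> by simp
  have Z0: "1 / cmod (A $$ (0, 0)) \<le> ?Z"
    using Z[of 0] n by (simp add: nekrasov_z_unfold[of A 0])
  have a0: "0 < cmod (A $$ (0, 0))" using pos n by simp
  then have "0 \<le> ?Z"
    using Z0 by (meson order_trans zero_le_divide_1_iff less_imp_le)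
  have gK: "1 \<le> ?g * ?K"
    using \<open>0 < ?g\<close> by (simp add: pos_divide_le_eq[symmetric] mult.commute[of ?g])
  have HK: "1 \<le> (1 - ?H) * ?K"
    using \<open>?H < 1\<close> by (simp add: pos_divide_le_eq[symmetric] mult.commute[of "1 - ?H"])
  have "0 \<le> ?K" using \<open>0 < ?g\<close> by (simp add: le_max_iff_disj)
  have "mat_norm_inf (mat_inv A) \<le> max \<mu> 1 * (?Z * ?K)"
  proof (rule nekrasov_inverse_bound[OF n A nek])
    have "1 \<le> cmod (A $$ (0, 0)) * ?Z"
      using Z0 a0 by (simp add: field_simps)
    also have "\<dots> \<le> cmod (A $$ (0, 0)) * ?Z * (?g * ?K)"
      using gK a0 \<open>0 \<le> ?Z\<close> mult_left_mono[OF gK, of "cmod (A $$ (0, 0)) * ?Z"] by simp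
    also have "\<dots> = (cmod (A $$ (0, 0)) * ?g) * (?Z * ?K)" by (simp only: ac_simps)
    also have "cmod (A $$ (0, 0)) * ?g = \<mu> * cmod (A $$ (0, 0)) - nekrasov_h A 0"
      using a0 by (simp add: right_diff_distrib)
    finally show "1 \<le> (\<mu> * cmod (A $$ (0, 0)) - nekrasov_h A 0) * (?Z * ?K)" .
  next
    fix i assume i: "0 < i" "i < n"
    let ?a = "cmod (A $$ (i, i))"
    note ai = pos[OF i(2)]
    have "nekrasov_z A i \<le> ?a * ?Z"
      using Z[OF i(2)] ai by (simp add: pos_divide_le_eq mult.commute[of ?a])
    also have "\<dots> \<le> ?a * ?Z * ((1 - ?H) * ?K)"
      using ai \<open>0 \<le> ?Z\<close> mult_left_mono[OF HK, of "?a * ?Z"] by simp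
    also have "\<dots> = (?a * (1 - ?H)) * (?Z * ?K)" by (simp only: ac_simps)
    also have "\<dots> \<le> (?a - nekrasov_h A i) * (?Z * ?K)"
    proof (rule mult_right_mono)
      show "?a * (1 - ?H) \<le> ?a - nekrasov_h A i"
        using H[OF i] ai by (simp add: pos_divide_le_eq right_diff_distrib mult.commute[of ?a])
      show "0 \<le> ?Z * ?K" using \<open>0 \<le> ?Z\<close> \<open>0 \<le> ?K\<close> by (rule mult_nonneg_nonneg)
    qed
    finally show "nekrasov_z A i \<le> (?a - nekrasov_h A i) * (?Z * ?K)" .
  qed
  then show ?thesis by (simp only: mult.assoc)
qed

text \<open>Here the row conditions on \<open>B\<close> are compared in their original form: the largest \<open>z\<^sub>i\<close> divided
  by the smallest of the gaps \<open>\<mu> a\<^sub>0 - h\<^sub>0\<close> and \<open>a\<^sub>i - h\<^sub>i\<close> satisfies all of them.\<close>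

lemma nekrasov_inverse_bound_unscaled:
  fixes \<mu> :: real
  assumes n: "n \<ge> 2" and A: "A \<in> carrier_mat n n" and nek: "nekrasov_mat A"
    and \<mu>: "nekrasov_h A 0 / cmod (A $$ (0, 0)) < \<mu>"
  shows "mat_norm_inf (mat_inv A) \<le>
      max \<mu> 1 * (MAX i\<in>{..<n}. nekrasov_z A i) /
      min (\<mu> * cmod (A $$ (0, 0)) - nekrasov_h A 0)
          (MIN i\<in>{..<n} - {0}. cmod (A $$ (i, i)) - nekrasov_h A i)"
    (is "_ \<le> _ * ?Z / min ?g ?M")
proof -
  let ?D = "min ?g ?M"
  have Z: "nekrasov_z A i \<le> ?Z" if "i < n" for i
    using that by (intro Max_ge) auto
  have Z1: "1 \<le> ?Z"
    using Z[of 0] n by (simp add: nekrasov_z_unfold[of A 0])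
  have M: "?M \<le> cmod (A $$ (i, i)) - nekrasov_h A i" if "0 < i" "i < n" for i
    using that by (intro Min_le) auto
  have "1 \<in> {..<n} - {0}" using n by simp
  then have ne: "{..<n} - {0} \<noteq> {}" by blast
  have "0 < ?M"
    using ne nek A by (subst Min_gr_iff) (auto simp: nekrasov_mat_def)
  moreover have "0 < ?g"
    using \<mu> nekrasov_diag_pos[OF nek A, of 0] n by (simp add: pos_divide_less_eq)
  ultimately have D: "0 < ?D" by simp
  have cert: "c \<le> d * (?Z / ?D)" if "c \<le> ?Z" "?D \<le> d" for c d
  proof -
    have "c \<le> ?D * (?Z / ?D)" using that(1) less_imp_neq[OF D] by simp
    also have "\<dots> \<le> d * (?Z / ?D)"
      using that(2) D Z1 by (intro mult_right_mono) auto
    finally show ?thesis .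
  qed
  have "mat_norm_inf (mat_inv A) \<le> max \<mu> 1 * (?Z / ?D)"
  proof (rule nekrasov_inverse_bound[OF n A nek])
    show "1 \<le> ?g * (?Z / ?D)" by (intro cert Z1) simp
    show "nekrasov_z A i \<le> (cmod (A $$ (i, i)) - nekrasov_h A i) * (?Z / ?D)"
      if "0 < i" "i < n" for i
      using M[OF that] by (intro cert Z that min.coboundedI2)
  qed
  then show ?thesis by simp
qed

theorem theorem7:
  fixes A :: "complex mat" and n :: nat and \<mu> :: real
  assumes "n \<ge> 2"
    and "A \<in> carrier_mat n n"
    and "nekrasov_mat A"
    and "\<mu> > offdiag_row_sum A 0 / cmod (A $$ (0, 0))"
  shows "invertible_mat A \<and>
    mat_norm_inf (mat_inv A) \<le>
      max \<mu> 1 * (MAX i\<in>{..<n}. nekrasov_z A i / cmod (A $$ (i, i))) *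
      max (1 / (\<mu> - nekrasov_h A 0 / cmod (A $$ (0, 0))))
          (1 / (1 - (MAX i\<in>{..<n} - {0}. nekrasov_h A i / cmod (A $$ (i, i))))) \<and>
    mat_norm_inf (mat_inv A) \<le>
      max \<mu> 1 * (MAX i\<in>{..<n}. nekrasov_z A i) /
      min (\<mu> * cmod (A $$ (0, 0)) - nekrasov_h A 0)
          (MIN i\<in>{..<n} - {0}. cmod (A $$ (i, i)) - nekrasov_h A i)"
proof -
  have "nekrasov_h A 0 / cmod (A $$ (0, 0)) < \<mu>"
    using assms(4) by (simp add: nekrasov_h.simps[of A 0])
  then show ?thesis
    using nekrasov_invertible[OF assms(1-3)] nekrasov_inverse_bound_scaled[OF assms(1-3)]
      nekrasov_inverse_bound_unscaled[OF assms(1-3)] by blast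
qed

end
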